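(* Let $n\geq 4$ and $r$ be integers satisfying $-1\leq r\leq n-2$. Then $$\frac{J_n(r+2)}{J_n(r)} \leq c_{n,r},\qquad\text{where}\qquad c_{n,r}=\frac{(n-r-2)(n-r)(n-r+2)}{(n+r)(n+r+2)(n+r+4)}.$$
   Context: For a positive integer $n$ and $r\in\mathbb{R}$, the Laplace–Pólya integral is $$J_n(r) = \frac1\pi\int_{-\infty}^{\infty} (\operatorname{sinc} t)^n\cos(rt)\,dt,$$ where $\operatorname{sinc} x = \frac{\sin x}{x}$ for $x\neq 0$ and $\operatorname{sinc} 0 = 1$. *)

theory Defs
  imports "HOL-Probability.Sinc_Integral"
begin

(* The integral is the Henstock-Kurzweil one: it agrees with the Lebesgue integral for
   n > 1, and for n = 1 it also covers the integrand, which is then only conditionally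
   (not absolutely) integrable. *)
definition laplace_polya :: "nat \<Rightarrow> real \<Rightarrow> real" where
  "laplace_polya n r = 1 / pi * integral UNIV (\<lambda>t. sinc t ^ n * cos (r * t))"

definition ratio_bound :: "nat \<Rightarrow> int \<Rightarrow> real" where
  "ratio_bound n r =
     ((real n - real_of_int r - 2) * (real n - real_of_int r) * (real n - real_of_int r + 2)) /
     ((real n + real_of_int r) * (real n + real_of_int r + 2) * (real n + real_of_int r + 4))"

end

theory Submission
  imports Defs
begin

text \<open>Integrating the derivative of \<open>t (sinc t)\<^sup>n cos (r t)\<close> over the line gives
  \<open>2 (n - 1) J\<^sub>n(r) = (n + r) J\<^sub>n\<^sub>-\<^sub>1(r + 1) + (n - r) J\<^sub>n\<^sub>-\<^sub>1(r - 1)\<close>, and \<open>J\<^sub>2\<close> is a piecewise linear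
  hat function by the Dirichlet integral. Induction on \<open>n\<close>, starting from the explicit values
  of \<open>J\<^sub>4\<close>, then proves the bound: for \<open>r \<ge> 0\<close> the bounds for \<open>n - 1\<close> at \<open>r + 1\<close> and \<open>r - 1\<close>
  combine to the one for \<open>n\<close> at \<open>r\<close>, and for \<open>r = -1\<close> there is equality since \<open>J\<^sub>n\<close> is even.\<close>

section \<open>Truncated integrals and dominated convergence\<close>

lemma abs_sinc_le_1: "\<bar>sinc t\<bar> \<le> 1"
  using abs_sin_x_le_abs_x[of t] by (auto simp: field_simps)

lemma mult_sinc: "t * sinc t = sin t"
  by simp

text \<open>Integrable majorant for dominated convergence: \<open>(sinc t)^2\<close> and
  \<open>t^2 * (sinc t)^2 = (sin t)^2\<close> are both at most 1; add the two bounds.\<close>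

lemma sinc_power_bound:
  assumes "n \<ge> 2"
  shows "\<bar>sinc t ^ n * cos (r * t)\<bar> \<le> 2 * inverse (1 + t\<^sup>2)"
proof -
  have "\<bar>sinc t ^ n * cos (r * t)\<bar> \<le> \<bar>sinc t\<bar> ^ n * 1"
    unfolding abs_mult power_abs by (intro mult_left_mono) auto
  also have "\<dots> \<le> \<bar>sinc t\<bar> ^ 2"
    using power_decreasing[OF assms abs_ge_zero abs_sinc_le_1] by (simp only: mult_1_right)
  also have "\<dots> \<le> 2 * inverse (1 + t\<^sup>2)"
  proof -
    have "\<bar>sinc t\<bar> ^ 2 \<le> 1"
      using power_mono[OF abs_sinc_le_1, of t 2] by (simp only: abs_ge_zero power_one)
    moreover have "t\<^sup>2 * \<bar>sinc t\<bar> ^ 2 \<le> 1"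
    proof -
      have "t\<^sup>2 * \<bar>sinc t\<bar> ^ 2 = (sin t)\<^sup>2"
        by (metis mult_sinc power2_abs power_mult_distrib)
      then show ?thesis
        by (simp only: abs_square_le_1 abs_sin_le_one)
    qed
    ultimately have "(1 + t\<^sup>2) * \<bar>sinc t\<bar> ^ 2 \<le> 2"
      by (simp only: distrib_right mult_1_left)
    moreover have "0 < 1 + t\<^sup>2"
      by (smt (verit) zero_le_power2)
    ultimately show ?thesis
      by (metis divide_inverse mult.commute pos_le_divide_eq)
  qed
  finally show ?thesis .
qed

text \<open>Symmetric truncation lets n = 1 enter as a limit of proper integrals, although its
  integrand is only conditionally integrable.\<close>

definition truncated_laplace_polya :: "nat \<Rightarrow> real \<Rightarrow> real \<Rightarrow> real" where
  "truncated_laplace_polya n r T = 1 / pi * integral {-T..T} (\<lambda>t. sinc t ^ n * cos (r * t))"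

lemma continuous_on_sinc_power: "continuous_on S (\<lambda>t. sinc t ^ n * cos (r * t))"
  by (intro continuous_intros)

lemma truncated_laplace_polya_tendsto:
  assumes "n \<ge> 2"
  shows "(\<lambda>k. truncated_laplace_polya n r (real k)) \<longlonglongrightarrow> laplace_polya n r"
proof -
  let ?g = "\<lambda>t. sinc t ^ n * cos (r * t)"
  let ?f = "\<lambda>k t. if t \<in> {-real k..real k} then ?g t else 0"
  let ?h = "\<lambda>t::real. 2 * inverse (1 + t\<^sup>2)"
  have int: "?h integrable_on UNIV"
    using set_borel_integral_eq_integral(1)[OF integrable_inverse_1_plus_square]
    by (intro integrable_on_mult_right) simp
  have "(\<lambda>k. integral UNIV (?f k)) \<longlonglongrightarrow> integral UNIV ?g"
  proof (rule dominated_convergence(2)[OF _ int])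
    show "?f k integrable_on UNIV" for k
      unfolding integrable_restrict_UNIV
      by (intro integrable_continuous_interval continuous_on_sinc_power)
    show "norm (?f k t) \<le> ?h t" for k t
      using sinc_power_bound[OF assms, of t r] by (cases "t \<in> {-real k..real k}") auto
    show "(\<lambda>k. ?f k t) \<longlonglongrightarrow> ?g t" for t
    proof (rule tendsto_eventually)
      obtain m where m: "\<bar>t\<bar> \<le> real m"
        using real_arch_simple by blast
      have "?f k t = ?g t" if "k \<ge> m" for k
      proof -
        have "real m \<le> real k" using that by simp
        with m have "t \<in> {-real k..real k}" by auto
        then show ?thesis by (simp only: if_True)
      qed
      then show "\<forall>\<^sub>F k in sequentially. ?f k t = ?g t"
        unfolding eventually_sequentially by blast
    qed
  qed
  then show ?thesis
    unfolding laplace_polya_def truncated_laplace_polya_def integral_restrict_UNIV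
    by (rule tendsto_mult_left)
qed

section \<open>The recurrence in n\<close>

text \<open>Differentiating \<open>t (sinc t)\<^sup>n\<^sup>+\<^sup>1 cos (r t)\<close> yields the recurrence because
  \<open>t sinc' t = cos t - sinc t\<close>.\<close>

lemma truncated_laplace_polya_Suc:
  assumes "T \<ge> 0"
  shows "real n * truncated_laplace_polya (Suc n) r T =
    (real n + 1 + r) / 2 * truncated_laplace_polya n (r + 1) T +
    (real n + 1 - r) / 2 * truncated_laplace_polya n (r - 1) T
    - 2 / pi * (T * sinc T ^ Suc n * cos (r * T))"
proof -
  define I where "I m s = integral {-T..T} (\<lambda>t. sinc t ^ m * cos (s * t))" for m s
  define F where "F t = t * sinc t ^ Suc n * cos (r * t)" for t
  let ?f = "\<lambda>t. (real n + 1 + r) / 2 * (sinc t ^ n * cos ((r + 1) * t))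
     + (real n + 1 - r) / 2 * (sinc t ^ n * cos ((r - 1) * t))
     - real n * (sinc t ^ Suc n * cos (r * t))"
  have I: "((\<lambda>t. sinc t ^ m * cos (s * t)) has_integral I m s) {-T..T}" for m s
    unfolding I_def by (intro integrable_integral integrable_continuous_interval continuous_on_sinc_power)
  have "(?f has_integral (F T - F (-T))) {-T..T}"
  \<comment> \<open>The formula \<open>sin t / t\<close> agrees with \<open>sinc\<close> only off 0,
    so 0 is the exceptional point, where continuity of \<open>F\<close> suffices.\<close>
  proof (rule fundamental_theorem_of_calculus_interior_strong[of "{0}"])
    show "continuous_on {-T..T} F"
      unfolding F_def by (intro continuous_intros)
    show "(F has_vector_derivative ?f t) (at t)" if "t \<in> {-T<..<T} - {0}" for t
    proof -
      have t: "t \<noteq> 0" using that by simp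
      define s where "s = sin t / t"
      have "((\<lambda>t. t * (sin t / t) ^ Suc n * cos (r * t)) has_real_derivative
          s ^ Suc n * cos (r * t) + real (Suc n) * s ^ n * (cos t - s) * cos (r * t)
          - t * s ^ Suc n * (r * sin (r * t))) (at t)"
        unfolding s_def using t
        by (auto intro!: derivative_eq_intros simp del: power_Suc) (simp add: field_simps)
      moreover have "s ^ Suc n * cos (r * t) + real (Suc n) * s ^ n * (cos t - s) * cos (r * t)
          - t * s ^ Suc n * (r * sin (r * t)) =
         (real n + 1 + r) / 2 * (s ^ n * cos ((r + 1) * t))
         + (real n + 1 - r) / 2 * (s ^ n * cos ((r - 1) * t)) - real n * (s ^ Suc n * cos (r * t))"
      proof -
        \<comment> \<open>Lowers the power of \<open>s\<close> in the sine term, so that the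
          addition formulas merge it with the cosine term into frequencies r + 1 and r - 1.\<close>
        have ts: "t * s ^ Suc n = s ^ n * sin t"
          using t by (simp add: s_def)
        have cc: "cos ((r + 1) * t) = cos (r * t) * cos t - sin (r * t) * sin t"
          "cos ((r - 1) * t) = cos (r * t) * cos t + sin (r * t) * sin t"
          by (simp_all add: distrib_right left_diff_distrib cos_add cos_diff)
        then show ?thesis
          unfolding ts cc by (simp add: field_simps)
      qed
      moreover have "sinc t = s"
        using t by (simp add: s_def)
      ultimately have "((\<lambda>t. t * (sin t / t) ^ Suc n * cos (r * t)) has_vector_derivative ?f t) (at t)"
        by (simp only: has_real_derivative_iff_has_vector_derivative)
      then show ?thesis
        by (rule has_vector_derivative_transform_within_open[of _ _ _ "-{0}"])
          (use t in \<open>auto simp: F_def\<close>)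
    qed
  qed (use assms in auto)
  moreover have "(?f has_integral ((real n + 1 + r) / 2 * I n (r + 1)
     + (real n + 1 - r) / 2 * I n (r - 1) - real n * I (Suc n) r)) {-T..T}"
    by (intro has_integral_diff has_integral_add has_integral_mult_right I)
  ultimately have "(real n + 1 + r) / 2 * I n (r + 1) + (real n + 1 - r) / 2 * I n (r - 1)
     - real n * I (Suc n) r = F T - F (-T)"
    by (rule has_integral_unique[rotated])
  moreover have "F (-T) = - F T"
    unfolding F_def by (simp only: sinc_neg mult_minus_left mult_minus_right cos_minus)
  ultimately have "real n * I (Suc n) r = (real n + 1 + r) / 2 * I n (r + 1)
     + (real n + 1 - r) / 2 * I n (r - 1) - 2 * F T"
    by linarith
  then have "1 / pi * (real n * I (Suc n) r) = 1 / pi * ((real n + 1 + r) / 2 * I n (r + 1)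
     + (real n + 1 - r) / 2 * I n (r - 1) - 2 * F T)"
    by (rule arg_cong)
  then show ?thesis
    unfolding truncated_laplace_polya_def I_def[symmetric] F_def[symmetric]
    by (simp add: algebra_simps diff_divide_distrib add_divide_distrib)
qed

text \<open>The boundary term vanishes in the limit, since |T sinc(T)^(n+1)| = |sin T| |sinc T|^n
  \<le> 1/T for T \<ge> 1. The limits \<open>a\<close> and \<open>b\<close> are left abstract to
  include n = 1, where they come from the Dirichlet integral.\<close>

lemma laplace_polya_rec_limit:
  assumes "n \<ge> 1"
    and "(\<lambda>k. truncated_laplace_polya n (r + 1) (real k)) \<longlonglongrightarrow> a"
    and "(\<lambda>k. truncated_laplace_polya n (r - 1) (real k)) \<longlonglongrightarrow> b"
  shows "real n * laplace_polya (Suc n) r = (real n + 1 + r) / 2 * a + (real n + 1 - r) / 2 * b"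
proof -
  have boundary: "(\<lambda>k. real k * sinc (real k) ^ Suc n * cos (r * real k)) \<longlonglongrightarrow> 0"
  proof (rule Lim_null_comparison)
    show "(\<lambda>k. inverse (real k)) \<longlonglongrightarrow> 0"
      by (rule lim_inverse_n)
    show "\<forall>\<^sub>F k in sequentially.
        norm (real k * sinc (real k) ^ Suc n * cos (r * real k)) \<le> inverse (real k)"
    proof (rule eventually_sequentiallyI)
      fix k :: nat
      assume k: "k \<ge> 1"
      have "norm (real k * sinc (real k) ^ Suc n * cos (r * real k))
          \<le> \<bar>real k * sinc (real k) ^ Suc n\<bar> * 1"
        unfolding real_norm_def abs_mult by (intro mult_left_mono) auto
      also have "\<dots> = \<bar>sin (real k)\<bar> * \<bar>sinc (real k)\<bar> ^ n"
        unfolding power_Suc mult.assoc[symmetric] mult_sinc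
        by (simp only: abs_mult power_abs mult_1_right)
      also have "\<dots> \<le> 1 * \<bar>sinc (real k)\<bar> ^ 1"
        by (intro mult_mono power_decreasing abs_sinc_le_1 assms(1)) auto
      also have "\<dots> \<le> inverse (real k)"
        using k by (simp add: divide_inverse[symmetric] divide_right_mono inverse_eq_divide)
      finally show "norm (real k * sinc (real k) ^ Suc n * cos (r * real k)) \<le> inverse (real k)" .
    qed
  qed
  have "(\<lambda>k. real n * truncated_laplace_polya (Suc n) r (real k)) \<longlonglongrightarrow>
      (real n + 1 + r) / 2 * a + (real n + 1 - r) / 2 * b - 2 / pi * 0"
    unfolding truncated_laplace_polya_Suc[OF of_nat_0_le_iff]
    by (intro tendsto_intros assms boundary)
  moreover have "(\<lambda>k. real n * truncated_laplace_polya (Suc n) r (real k)) \<longlonglongrightarrow>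
      real n * laplace_polya (Suc n) r"
    using assms(1) by (intro tendsto_mult_left truncated_laplace_polya_tendsto) simp
  ultimately show ?thesis
    using LIMSEQ_unique by force
qed

lemma laplace_polya_Suc:
  assumes "n \<ge> 2"
  shows "2 * real n * laplace_polya (Suc n) r =
    (real n + 1 + r) * laplace_polya n (r + 1) + (real n + 1 - r) * laplace_polya n (r - 1)"
  using laplace_polya_rec_limit[OF _ truncated_laplace_polya_tendsto[OF assms]
      truncated_laplace_polya_tendsto[OF assms], of r] assms
  by simp

section \<open>The Dirichlet integral and the values for n = 2\<close>

lemma Si_scaled_tendsto: "(\<lambda>k. Si (a * real k) - Si (- a * real k)) \<longlonglongrightarrow> pi * sgn a"
proof -
  have pos: "(\<lambda>k. Si (b * real k) - Si (- b * real k)) \<longlonglongrightarrow> pi" if "b > 0" for b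
  proof -
    have "filterlim (\<lambda>k. b * real k) at_top sequentially"
      using that by (intro filterlim_tendsto_pos_mult_at_top[OF tendsto_const]
          filterlim_real_sequentially)
    then have "(\<lambda>k. Si (b * real k)) \<longlonglongrightarrow> pi / 2"
      by (rule filterlim_compose[OF Si_at_top])
    then have "(\<lambda>k. 2 * Si (b * real k)) \<longlonglongrightarrow> 2 * (pi / 2)"
      by (rule tendsto_mult_left)
    moreover have "Si (b * real k) - Si (- b * real k) = 2 * Si (b * real k)" for k
      using Si_neg[of "b * real k"] that by simp
    ultimately show ?thesis
      by (simp only:) simp
  qed
  consider "a > 0" | "a = 0" | "a < 0"
    by linarith
  then show ?thesis
  proof cases
    case 3
    then show ?thesis
      using tendsto_minus[OF pos[of "-a"]] by simp
  qed (use pos[of a] in auto)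
qed

text \<open>The product sin t cos(rt) splits into sines of frequencies 1 + r and 1 - r, each giving
  a Dirichlet integral. The limit is 1 for |r| < 1, 1/2 for |r| = 1 and 0 beyond.\<close>

lemma truncated_laplace_polya_1_tendsto:
  "(\<lambda>k. truncated_laplace_polya 1 r (real k)) \<longlonglongrightarrow> (sgn (1 + r) + sgn (1 - r)) / 2"
proof -
  \<comment> \<open>The factor \<open>a\<close> stays inside the integrand to avoid dividing by it,
    so a = 0 is covered as well.\<close>
  have scaled: "((\<lambda>t. a * sinc (a * t)) has_integral (Si (a * T) - Si (- a * T))) {-T..T}"
    if "T \<ge> 0" for a T
  proof -
    have "((\<lambda>t. Si (a * t)) has_real_derivative a * sinc (a * t)) (at t)" for t
    proof -
      have "((\<lambda>t. a * t) has_real_derivative a) (at t)"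
        by (auto intro!: derivative_eq_intros)
      from DERIV_chain2[OF DERIV_Si this] show ?thesis
        by (simp only: mult.commute)
    qed
    then have "((\<lambda>t. a * sinc (a * t)) has_integral (Si (a * T) - Si (a * - T))) {-T..T}"
      using that by (intro fundamental_theorem_of_calculus)
        (simp_all only: has_real_derivative_iff_has_vector_derivative[symmetric]
          has_field_derivative_at_within)
    then show ?thesis
      by simp
  qed
  have split: "sinc t ^ 1 * cos (r * t)
      = 1 / 2 * ((1 + r) * sinc ((1 + r) * t) + (1 - r) * sinc ((1 - r) * t))" for t
  proof (cases "t = 0")
    case False
    have scale: "a * sinc (a * t) = sin (a * t) / t" for a
      using False by simp
    have "sin ((1 + r) * t) + sin ((1 - r) * t) = 2 * sin t * cos (r * t)"
      by (simp add: distrib_right left_diff_distrib sin_add sin_diff)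
    then have "sin ((1 + r) * t) / t + sin ((1 - r) * t) / t = 2 * sin t * cos (r * t) / t"
      by (simp only: add_divide_distrib[symmetric])
    moreover have "sinc t = sin t / t"
      using False by simp
    ultimately show ?thesis
      unfolding scale by simp
  qed simp
  have eq: "truncated_laplace_polya 1 r (real k) = 1 / pi * (1 / 2 *
      ((Si ((1 + r) * real k) - Si (- (1 + r) * real k)) +
       (Si ((1 - r) * real k) - Si (- (1 - r) * real k))))" for k
    unfolding truncated_laplace_polya_def split
    by (intro arg_cong[where f = "(*) (1 / pi)"] integral_unique has_integral_mult_right
        has_integral_add scaled) auto
  have "(\<lambda>k. truncated_laplace_polya 1 r (real k)) \<longlonglongrightarrow>
      1 / pi * (1 / 2 * (pi * sgn (1 + r) + pi * sgn (1 - r)))"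
    unfolding eq by (intro tendsto_mult_left tendsto_add Si_scaled_tendsto)
  then show ?thesis
    by (simp flip: distrib_left)
qed

text \<open>The hat function max(0, 1 - |r|/2), from the recurrence applied to the limits for n =
  1.\<close>

lemma laplace_polya_2: "laplace_polya 2 r = (\<bar>r + 2\<bar> + \<bar>r - 2\<bar> - 2 * \<bar>r\<bar>) / 4"
proof -
  have "laplace_polya 2 r = (2 + r) / 2 * ((sgn (2 + r) + sgn (- r)) / 2)
      + (2 - r) / 2 * ((sgn r + sgn (2 - r)) / 2)"
    using laplace_polya_rec_limit[OF _ truncated_laplace_polya_1_tendsto
        truncated_laplace_polya_1_tendsto, of r]
    by (simp add: numeral_2_eq_2)
  then show ?thesis
    by (simp add: sgn_if abs_if split: if_splits)
qed

section \<open>Symmetry, support and sign\<close>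

lemma laplace_polya_minus: "laplace_polya n (- r) = laplace_polya n r"
  by (simp add: laplace_polya_def)

text \<open>If r \<ge> n + 1, then r + 1 and r - 1 are both at least n, so both terms of the
  recurrence vanish.\<close>

lemma laplace_polya_eq_0:
  assumes "n \<ge> 2" and "r \<ge> real n"
  shows "laplace_polya n r = 0"
  using assms
proof (induction n arbitrary: r rule: dec_induct)
  case base
  then show ?case
    by (simp add: laplace_polya_2)
next
  case (step n)
  have "laplace_polya n (r + 1) = 0" "laplace_polya n (r - 1) = 0"
    using step.prems by (auto intro: step.IH)
  then show ?case
    using laplace_polya_Suc[OF step.hyps(1), of r] step.hyps by simp
qed

text \<open>For |r| < n + 1 both coefficients of the recurrence are nonnegative; for larger |r|
  evenness and the support give the value 0.\<close>

lemma laplace_polya_nonneg: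
  assumes "n \<ge> 2"
  shows "laplace_polya n r \<ge> 0"
  using assms
proof (induction n arbitrary: r rule: dec_induct)
  case base
  then show ?case
    by (simp add: laplace_polya_2)
next
  case (step n)
  show ?case
  proof (cases "\<bar>r\<bar> \<ge> real (Suc n)")
    case True
    have "laplace_polya (Suc n) \<bar>r\<bar> = 0"
      using True step.hyps by (intro laplace_polya_eq_0) auto
    then show ?thesis
      using laplace_polya_minus[of "Suc n" r] by (cases "r \<ge> 0") auto
  next
    case False
    then have "real n + 1 + r \<ge> 0" "real n + 1 - r \<ge> 0"
      by auto
    then have "0 \<le> (real n + 1 + r) * laplace_polya n (r + 1)
        + (real n + 1 - r) * laplace_polya n (r - 1)"
      by (intro add_nonneg_nonneg[OF mult_nonneg_nonneg mult_nonneg_nonneg] step.IH)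
    then have "0 \<le> 2 * real n * laplace_polya (Suc n) r"
      using laplace_polya_Suc[OF step.hyps(1), of r] by simp
    then show ?thesis
      using step.hyps by (simp add: zero_le_mult_iff)
  qed
qed

section \<open>The ratio bound by induction\<close>

text \<open>In the variables \<open>p = n + r\<close> and \<open>q = n - r\<close> the ratio bound is
  \<open>(q - 2) q (q + 2) / (p (p + 2) (p + 4))\<close>, and \<open>X\<close>, \<open>Y\<close>, \<open>Z\<close> are the values at
  \<open>r + 3\<close>, \<open>r + 1\<close>, \<open>r - 1\<close> for \<open>n - 1\<close>. Eliminating \<open>X\<close> and \<open>Z\<close> leaves, up to the
  factor \<open>Y\<close>, the difference \<open>(p - q) (p - q + 2) (p - q + 4) \<ge> 0\<close>. For \<open>q = 3\<close>
  the bound on \<open>X\<close> would be negative, so there \<open>X = 0\<close> is used instead.\<close>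

lemma ratio_step:
  fixes p q X Y Z :: real
  assumes pq: "p \<ge> q" "q \<ge> 2" and "Y \<ge> 0"
    and XY: "X * (p * (p + 2) * (p + 4)) \<le> (q - 4) * (q - 2) * q * Y \<or> q = 3 \<and> X = 0 \<and> p \<ge> 5"
    and YZ: "Y * ((p - 2) * p * (p + 2)) \<le> (q - 2) * q * (q + 2) * Z"
  shows "((p + 2) * X + (q - 2) * Y) * (p * (p + 2) * (p + 4))
    \<le> (q - 2) * q * (q + 2) * (p * Y + q * Z)"
proof -
  \<comment> \<open>Eliminates \<open>Z\<close>: adding p Y (q - 2) q (q + 2) to both sides collects
    the left side into p q Y ((p^2 - 4) + (q^2 - 4)).\<close>
  have "q * ((p - 2) * p * (p + 2) * Y) \<le> q * ((q - 2) * q * (q + 2) * Z)"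
    using YZ pq by (intro mult_left_mono) (auto simp: mult_ac)
  then have rhs: "p * q * Y * (p\<^sup>2 + q\<^sup>2 - 8) \<le> (q - 2) * q * (q + 2) * (p * Y + q * Z)"
    by (simp add: algebra_simps power2_eq_square)
  show ?thesis
    using XY
  proof
    assume *: "X * (p * (p + 2) * (p + 4)) \<le> (q - 4) * (q - 2) * q * Y"
    have "(p + 2) * (X * (p * (p + 2) * (p + 4))) \<le> (p + 2) * ((q - 4) * (q - 2) * q * Y)"
      using * pq by (intro mult_left_mono) auto
    moreover have "0 \<le> Y * ((p - q) * (p - q + 2) * (p - q + 4))"
      using assms(1,3) by (intro mult_nonneg_nonneg) auto
    ultimately show ?thesis
      using rhs by (simp add: algebra_simps power2_eq_square)
  next
    assume *: "q = 3 \<and> X = 0 \<and> p \<ge> 5"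
    \<comment> \<open>With q = 3 and X = 0 the claim reduces to (p + 2)(p + 4) \<le> 3(p^2 + 1),
      that is 2 p^2 - 6 p - 5 \<ge> 0.\<close>
    have "p * p \<ge> 5 * p"
      using * by (intro mult_right_mono) auto
    moreover have "3 * (p\<^sup>2 + 1) - (p + 2) * (p + 4) = 2 * (p * p) - 6 * p - 5"
      by (simp add: algebra_simps power2_eq_square)
    ultimately have "(p + 2) * (p + 4) \<le> 3 * (p\<^sup>2 + 1)"
      using * by linarith
    then have "(p * Y) * ((p + 2) * (p + 4)) \<le> (p * Y) * (3 * (p\<^sup>2 + 1))"
      using * \<open>Y \<ge> 0\<close> by (intro mult_left_mono) auto
    then show ?thesis
      using rhs * by (simp add: algebra_simps power2_eq_square)
  qed
qed

lemma laplace_polya_4: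
  "laplace_polya 4 0 = 2 / 3" "laplace_polya 4 1 = 23 / 48" "laplace_polya 4 2 = 1 / 6"
  "laplace_polya 4 3 = 1 / 48"
proof -
  have L3: "4 * laplace_polya 3 r = (3 + r) * laplace_polya 2 (r + 1) + (3 - r) * laplace_polya 2 (r - 1)"
    for r
    using laplace_polya_Suc[of 2 r] by simp
  have L4: "6 * laplace_polya 4 r = (4 + r) * laplace_polya 3 (r + 1) + (4 - r) * laplace_polya 3 (r - 1)"
    for r
    using laplace_polya_Suc[of 3 r] by simp
  \<comment> \<open>The six arguments are those that \<open>L4\<close> at 0, 1, 2, 3 refers
    to.\<close>
  have v: "laplace_polya 3 (-1) = 1 / 2" "laplace_polya 3 0 = 3 / 4" "laplace_polya 3 1 = 1 / 2"
    "laplace_polya 3 2 = 1 / 8" "laplace_polya 3 3 = 0" "laplace_polya 3 4 = 0"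
    using L3[of "-1"] L3[of 0] L3[of 1] L3[of 2] L3[of 3] L3[of 4]
    by (simp_all add: laplace_polya_2)
  show "laplace_polya 4 0 = 2 / 3" "laplace_polya 4 1 = 23 / 48" "laplace_polya 4 2 = 1 / 6"
    "laplace_polya 4 3 = 1 / 48"
    using L4[of 0] L4[of 1] L4[of 2] L4[of 3] v by simp_all
qed

text \<open>The cross-multiplied form is linear in the values of J, so the recurrence can be
  substituted directly on both sides.\<close>

lemma laplace_polya_ratio:
  fixes r :: int
  assumes "n \<ge> 4" and "-1 \<le> r" and "r \<le> int n - 2"
  shows "laplace_polya n (real_of_int r + 2) *
      ((real n + r) * (real n + r + 2) * (real n + r + 4))
    \<le> (real n - r - 2) * (real n - r) * (real n - r + 2) * laplace_polya n r"
  using assms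
proof (induction n arbitrary: r rule: dec_induct)
  case base
  then consider "r = -1" | "r = 0" | "r = 1" | "r = 2"
    by fastforce
  then show ?case
  proof cases
    case 4
    then show ?thesis
      using laplace_polya_eq_0[of 4 4] by simp
  qed (use laplace_polya_4 laplace_polya_minus[of 4 1] in simp_all)
next
  case (step n)
  show ?case
  proof (cases "r = -1")
    \<comment> \<open>Here r + 2 = 1 = -r, and both triple products are N^3-type products (N - 1)(N
      + 1)(N + 3) with N = n + 1.\<close>
    case True
    then show ?thesis
      using laplace_polya_minus[of "Suc n" 1] by (simp add: algebra_simps)
  next
    case False
    define p q where "p = real n + 1 + real_of_int r" and "q = real n + 1 - real_of_int r"
    define X Y Z where "X = laplace_polya n (real_of_int r + 3)"
      and "Y = laplace_polya n (real_of_int r + 1)" and "Z = laplace_polya n (real_of_int r - 1)"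
    have r: "0 \<le> r" "r \<le> int n - 1" "4 \<le> n"
      using False step by auto
    \<comment> \<open>The induction hypothesis at r - 1 requires r - 1 \<ge> -1, which is why r = -1
      is treated apart.\<close>
    have YZ: "Y * ((p - 2) * p * (p + 2)) \<le> (q - 2) * q * (q + 2) * Z"
      using step.IH[of "r - 1"] r unfolding p_def q_def Y_def Z_def by (simp add: algebra_simps)
    have XY: "X * (p * (p + 2) * (p + 4)) \<le> (q - 4) * (q - 2) * q * Y \<or> q = 3 \<and> X = 0 \<and> p \<ge> 5"
    proof -
      \<comment> \<open>The induction hypothesis at r + 1 reaches only r \<le> n - 3. For the last
        two values of r, the argument r + 3 of \<open>X\<close> lies outside the support; at q = 2
        the factor q - 2 then makes both sides 0.\<close>
      consider "r \<le> int n - 3" | "r = int n - 2" | "r = int n - 1"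
        using r by linarith
      then show ?thesis
      proof cases
        case 1
        then show ?thesis
          using step.IH[of "r + 1"] r unfolding p_def q_def X_def Y_def by (simp add: algebra_simps)
      next
        case 2
        then have "X = 0"
          unfolding X_def using r by (intro laplace_polya_eq_0) auto
        then show ?thesis
          using 2 r unfolding p_def q_def by simp
      next
        case 3
        then have "X = 0"
          unfolding X_def using r by (intro laplace_polya_eq_0) auto
        moreover have "q = 2"
          using 3 unfolding q_def by simp
        ultimately show ?thesis
          by simp
      qed
    qed
    have "p \<ge> q" "q \<ge> 2"
      using r unfolding p_def q_def by linarith+
    moreover have "Y \<ge> 0"
      unfolding Y_def using r by (intro laplace_polya_nonneg) simp
    ultimately have "((p + 2) * X + (q - 2) * Y) * (p * (p + 2) * (p + 4))
        \<le> (q - 2) * q * (q + 2) * (p * Y + q * Z)"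
      using XY YZ by (rule ratio_step)
    moreover have "(p + 2) * X + (q - 2) * Y = 2 * real n * laplace_polya (Suc n) (real_of_int r + 2)"
      using laplace_polya_Suc[of n "real_of_int r + 2"] r
      unfolding p_def q_def X_def Y_def by (simp add: algebra_simps)
    moreover have "p * Y + q * Z = 2 * real n * laplace_polya (Suc n) (real_of_int r)"
      using laplace_polya_Suc[of n "real_of_int r"] r
      unfolding p_def q_def Y_def Z_def by simp
    ultimately have "(2 * real n) * (laplace_polya (Suc n) (real_of_int r + 2) * (p * (p + 2) * (p + 4)))
        \<le> (2 * real n) * ((q - 2) * q * (q + 2) * laplace_polya (Suc n) (real_of_int r))"
      by (simp only: mult_ac)
    moreover have "2 * real n > 0"
      using r by simp
    ultimately have "laplace_polya (Suc n) (real_of_int r + 2) * (p * (p + 2) * (p + 4))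
        \<le> (q - 2) * q * (q + 2) * laplace_polya (Suc n) (real_of_int r)"
      by (simp only: mult_le_cancel_left_pos)
    then show ?thesis
      unfolding p_def q_def by (simp add: algebra_simps)
  qed
qed

theorem theorem1p4:
  fixes n :: nat and r :: int
  assumes "n \<ge> 4" and "-1 \<le> r" and "r \<le> int n - 2"
  shows "laplace_polya n (real_of_int r + 2) / laplace_polya n (real_of_int r) \<le> ratio_bound n r"
proof -
  define N D where "N = (real n - real_of_int r - 2) * (real n - real_of_int r) * (real n - real_of_int r + 2)"
    and "D = (real n + real_of_int r) * (real n + real_of_int r + 2) * (real n + real_of_int r + 4)"
  have ND: "N \<ge> 0" "D > 0"
    unfolding N_def D_def using assms by (auto intro!: mult_nonneg_nonneg mult_pos_pos)
  have le: "laplace_polya n (real_of_int r + 2) * D \<le> N * laplace_polya n (real_of_int r)"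
    using laplace_polya_ratio[OF assms] unfolding N_def D_def .
  have nonneg: "laplace_polya n (real_of_int r) \<ge> 0"
    using assms by (intro laplace_polya_nonneg) simp
  have "laplace_polya n (real_of_int r + 2) / laplace_polya n (real_of_int r) \<le> N / D"
  \<comment> \<open>If the denominator were 0, the quotient would be 0 by convention, and N / D is
    nonnegative.\<close>
  proof (cases "laplace_polya n (real_of_int r) = 0")
    case False
    then show ?thesis
      using le nonneg ND by (simp add: divide_simps)
  qed (use ND in simp)
  then show ?thesis
    by (simp add: ratio_bound_def N_def D_def)
qed

end
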